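(* Let $\mathcal M$ be a randomized mechanism and $\approx$ a nonempty (not necessarily symmetric) neighboring relation on its inputs. Let $f$ be the optimal tradeoff function and $\delta$ the privacy profile of $\mathcal M$ with respect to $\approx$. Then: (Primal to dual) for every $\varepsilon\in\mathbb R$, $\displaystyle \delta(\varepsilon)=1+(f^{-1})^*(-e^{\varepsilon})$; (Dual to primal) for every $\alpha\in[0,1]$, $\displaystyle f(\alpha)=\sup_{\varepsilon\in\mathbb R}e^{-\varepsilon}\bigl(1-\delta(\varepsilon)-\alpha\bigr)$.
   Context: A randomized mechanism $\mathcal M$ maps each input $X$ to a probability distribution $\mathcal M(X)$ on a fixed output space. A hypothesis test is a (measurable) function $h$ from the output space to $[0,1]$. For distributions $P,Q$ the tradeoff function is $\Lambda(P\|Q)(\alpha)=\inf\{\mathbb E_{z\sim Q}[1-h(z)]: h\text{ a hypothesis test},\ \mathbb E_{z\sim P}[h(z)]=\alpha\}$, $\alpha\in[0,1]$. A function $f:[0,1]\to[0,1]$ is called a tradeoff function if it is convex, continuous, non-increasing and $f(\alpha)\le1-\alpha$ for all $\alpha$. $\mathcal M$ is $f$-DP with respect to $\approx$ if $\Lambda(\mathcal M(X)\|\mathcal M(X'))\ge f$ pointwise for all $X\approx X'$. The optimal tradeoff function of $(\mathcal M,\approx)$ is the tradeoff function $f$ such that $\mathcal M$ is $f$-DP with respect to $\approx$ and every tradeoff function $f'$ for which $\mathcal M$ is $f'$-DP with respect to $\approx$ satisfies $f'\le f$. The hockey-stick divergence is $D^{\mathrm{HS}}_{\alpha}(P\|Q)=\int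 (p(y)-\alpha q(y))_+\,dy$ with $p,q$ densities of $P,Q$ with respect to a common dominating measure, and the privacy profile is $\delta(\varepsilon)=\sup_{X\approx X'}D^{\mathrm{HS}}_{e^{\varepsilon}}(\mathcal M(X)\|\mathcal M(X'))$. For a tradeoff function $f$, $f^{-1}(\alpha)=\inf\{t\in[0,1]:f(t)\le\alpha\}$, $\alpha\in[0,1]$. For $g:[0,1]\to\mathbb R$, the convex conjugate is that of the extension of $g$ by $+\infty$ outside $[0,1]$: $g^*(s)=\sup_{t\in[0,1]}(st-g(t))$. *)

theory Defs
  imports "HOL-Probability.Probability"
begin

definition hypothesis_test :: "'y measure \<Rightarrow> ('y \<Rightarrow> real) \<Rightarrow> bool" where
  "hypothesis_test N h \<longleftrightarrow> h \<in> borel_measurable N \<and> (\<forall>y\<in>space N. h y \<in> {0..1})"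

(* The set below is nonempty for probability measures and alpha in [0,1] (take h constant) and
   bounded below by 0, so the real infimum is the intended one. *)
definition tradeoff :: "'y measure \<Rightarrow> 'y measure \<Rightarrow> real \<Rightarrow> real" where
  "tradeoff P Q \<alpha> =
     Inf {(LINT z|Q. 1 - h z) | h. hypothesis_test P h \<and> (LINT z|P. h z) = \<alpha>}"

(* Functions on [0,1] are represented by functions on the reals; only their values on [0,1] matter. *)
definition tradeoff_function :: "(real \<Rightarrow> real) \<Rightarrow> bool" where
  "tradeoff_function f \<longleftrightarrow>
     f \<in> {0..1} \<rightarrow> {0..1} \<and> convex_on {0..1} f \<and> continuous_on {0..1} f \<and>
     antimono_on {0..1} f \<and> (\<forall>\<alpha>\<in>{0..1}. f \<alpha> \<le> 1 - \<alpha>)"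

definition f_DP ::
  "('x \<Rightarrow> 'y measure) \<Rightarrow> ('x \<Rightarrow> 'x \<Rightarrow> bool) \<Rightarrow> (real \<Rightarrow> real) \<Rightarrow> bool" where
  "f_DP M R f \<longleftrightarrow>
     (\<forall>X X'. R X X' \<longrightarrow> (\<forall>\<alpha>\<in>{0..1}. tradeoff (M X) (M X') \<alpha> \<ge> f \<alpha>))"

definition optimal_tradeoff_function ::
  "('x \<Rightarrow> 'y measure) \<Rightarrow> ('x \<Rightarrow> 'x \<Rightarrow> bool) \<Rightarrow> (real \<Rightarrow> real) \<Rightarrow> bool" where
  "optimal_tradeoff_function M R f \<longleftrightarrow>
     tradeoff_function f \<and> f_DP M R f \<and>
     (\<forall>f'. tradeoff_function f' \<and> f_DP M R f' \<longrightarrow> (\<forall>\<alpha>\<in>{0..1}. f' \<alpha> \<le> f \<alpha>))"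

definition add_measure :: "'y measure \<Rightarrow> 'y measure \<Rightarrow> 'y measure" where
  "add_measure P Q = measure_of (space P) (sets P) (\<lambda>A. emeasure P A + emeasure Q A)"

(* The common dominating measure is taken to be P + Q; hockey_stick_eq below shows that every
   other choice of dominating measure and densities gives the same value. *)
definition hockey_stick :: "real \<Rightarrow> 'y measure \<Rightarrow> 'y measure \<Rightarrow> real" where
  "hockey_stick a P Q =
     (let \<mu> = add_measure P Q;
          p = (\<lambda>y. enn2real (RN_deriv \<mu> P y));
          q = (\<lambda>y. enn2real (RN_deriv \<mu> Q y))
      in LINT y|\<mu>. max 0 (p y - a * q y))"

(* For a nonempty relation and probability measures the supremum is over a nonempty subset of
   [0,1]. *)
definition privacy_profile ::
  "('x \<Rightarrow> 'y measure) \<Rightarrow> ('x \<Rightarrow> 'x \<Rightarrow> bool) \<Rightarrow> real \<Rightarrow> real" where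
  "privacy_profile M R \<epsilon> = Sup {hockey_stick (exp \<epsilon>) (M X) (M X') | X X'. R X X'}"

definition tradeoff_inverse :: "(real \<Rightarrow> real) \<Rightarrow> real \<Rightarrow> real" where
  "tradeoff_inverse f \<alpha> = Inf {t\<in>{0..1}. f t \<le> \<alpha>}"

definition convex_conjugate :: "(real \<Rightarrow> real) \<Rightarrow> real \<Rightarrow> ereal" where
  "convex_conjugate g s = (SUP t\<in>{0..1}. ereal (s * t - g t))"

lemma space_add_measure [simp]: "space (add_measure P Q) = space P"
  and sets_add_measure [simp, measurable_cong]: "sets (add_measure P Q) = sets P"
  by (simp_all add: add_measure_def sets.space_closed sets.sigma_sets_eq)

lemma emeasure_add_measure:
  assumes "sets Q = sets P" "A \<in> sets P"
  shows "emeasure (add_measure P Q) A = emeasure P A + emeasure Q A"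
  unfolding add_measure_def
proof (rule emeasure_measure_of_sigma)
  show "sigma_algebra (space P) (sets P)" by (rule sets.sigma_algebra_axioms)
  show "positive (sets P) (\<lambda>A. emeasure P A + emeasure Q A)" by (simp add: positive_def)
  show "countably_additive (sets P) (\<lambda>A. emeasure P A + emeasure Q A)"
    using assms(1)
    by (auto simp: countably_additive_def suminf_add[symmetric] suminf_emeasure)
  show "A \<in> sets P" by fact
qed

lemma hockey_stick_eq:
  assumes P: "prob_space P" and Q: "prob_space Q"
    and [measurable]: "p \<in> borel_measurable \<mu>" "q \<in> borel_measurable \<mu>"
    and p0: "\<And>y. p y \<ge> 0" and q0: "\<And>y. q y \<ge> (0::real)"
    and Pd: "P = density \<mu> (\<lambda>y. ennreal (p y))" and Qd: "Q = density \<mu> (\<lambda>y. ennreal (q y))"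
  shows "hockey_stick a P Q = (LINT y|\<mu>. max 0 (p y - a * q y))"
proof -
  interpret P: prob_space P by fact
  interpret Q: prob_space Q by fact
  define \<nu> where "\<nu> = add_measure P Q"
  have sQ: "sets Q = sets P" and sP: "sets P = sets \<mu>" by (simp_all add: Pd Qd)
  have [measurable_cong]: "sets \<nu> = sets \<mu>" by (simp add: \<nu>_def sP)
  have em: "emeasure \<nu> A = emeasure P A + emeasure Q A" if "A \<in> sets \<mu>" for A
    using that emeasure_add_measure[OF sQ] by (simp add: \<nu>_def sP)
  have "emeasure \<nu> (space \<mu>) = 2"
    using P.emeasure_space_1 Q.emeasure_space_1 em[OF sets.top]
      sets_eq_imp_space_eq[OF sP] sets_eq_imp_space_eq[OF sQ] by simp
  then interpret \<nu>: finite_measure \<nu>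
    by (intro finite_measureI) (simp add: \<nu>_def sets_eq_imp_space_eq[OF sP])
  have \<nu>d: "\<nu> = density \<mu> (\<lambda>y. ennreal (p y + q y))"
  proof (rule measure_eqI)
    fix A assume "A \<in> sets \<nu>"
    then have [measurable]: "A \<in> sets \<mu>" by (simp add: \<nu>_def sP)
    show "emeasure \<nu> A = emeasure (density \<mu> (\<lambda>y. ennreal (p y + q y))) A"
      unfolding em[OF \<open>A \<in> sets \<mu>\<close>]
      by (simp add: Pd Qd emeasure_density p0 q0 distrib_right nn_integral_add)
  qed (simp add: \<nu>_def sP)
  have density_real: "AE y in \<mu>. d y = (p y + q y) * enn2real (RN_deriv \<nu> D y)"
    if D: "prob_space D" and [measurable]: "d \<in> borel_measurable \<mu>" and d0: "\<And>y. 0 \<le> d y"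
      and Dd: "D = density \<mu> (\<lambda>y. ennreal (d y))"
      and le: "\<And>A. A \<in> sets \<mu> \<Longrightarrow> emeasure D A \<le> emeasure \<nu> A"
    for D and d :: "_ \<Rightarrow> real"
  proof -
    interpret D: prob_space D by fact
    have sD: "sets D = sets \<nu>" by (simp add: Dd \<nu>_def sP)
    have ac: "absolutely_continuous \<nu> D"
      using le unfolding absolutely_continuous_def null_sets_def
      by (auto simp: sD) (metis \<open>sets \<nu> = sets \<mu>\<close> le_zero_eq)
    have "density \<mu> (\<lambda>y. ennreal (p y + q y) * RN_deriv \<nu> D y) = density \<nu> (RN_deriv \<nu> D)"
      using density_density_eq[of "\<lambda>y. ennreal (p y + q y)" \<mu> "RN_deriv \<nu> D"]
      by (simp add: \<nu>d[symmetric] del: ennreal_plus)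
    also have "\<dots> = D" by (rule \<nu>.density_RN_deriv[OF ac sD])
    finally have eq: "density \<mu> (\<lambda>y. ennreal (p y + q y) * RN_deriv \<nu> D y) = D" .
    have "AE y in \<mu>. ennreal (p y + q y) * RN_deriv \<nu> D y = RN_deriv \<mu> D y"
      by (rule RN_deriv_unique_sigma_finite[OF _ eq D.sigma_finite_measure_axioms]) simp
    moreover have "AE y in \<mu>. ennreal (d y) = RN_deriv \<mu> D y"
      by (rule RN_deriv_unique_sigma_finite[OF _ Dd[symmetric] D.sigma_finite_measure_axioms]) simp
    ultimately show ?thesis
    proof eventually_elim
      case (elim y)
      then have "d y = enn2real (ennreal (p y + q y) * RN_deriv \<nu> D y)"
        using d0[of y] by (metis enn2real_ennreal)
      then show ?case using p0[of y] q0[of y] by (simp add: enn2real_mult del: ennreal_plus)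
    qed
  qed
  have AEp: "AE y in \<mu>. p y = (p y + q y) * enn2real (RN_deriv \<nu> P y)"
    by (rule density_real[OF P _ p0 Pd]) (simp_all add: em)
  have AEq: "AE y in \<mu>. q y = (p y + q y) * enn2real (RN_deriv \<nu> Q y)"
    by (rule density_real[OF Q _ q0 Qd]) (simp_all add: em)
  have "hockey_stick a P Q =
      (LINT y|\<nu>. max 0 (enn2real (RN_deriv \<nu> P y) - a * enn2real (RN_deriv \<nu> Q y)))"
    by (simp add: hockey_stick_def \<nu>_def Let_def)
  also have "\<dots> = (LINT y|\<mu>. (p y + q y) *\<^sub>R
      max 0 (enn2real (RN_deriv \<nu> P y) - a * enn2real (RN_deriv \<nu> Q y)))"
    using integral_density[of "\<lambda>y. max 0 (enn2real (RN_deriv \<nu> P y) - a * enn2real (RN_deriv \<nu> Q y))"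
        \<mu> "\<lambda>y. p y + q y"] p0 q0
    by (simp add: \<nu>d[symmetric] del: ennreal_plus)
  also have "\<dots> = (LINT y|\<mu>. max 0 (p y - a * q y))"
  proof (rule integral_cong_AE)
    show "AE y in \<mu>. (p y + q y) *\<^sub>R
        max 0 (enn2real (RN_deriv \<nu> P y) - a * enn2real (RN_deriv \<nu> Q y)) = max 0 (p y - a * q y)"
      using AEp AEq
    proof eventually_elim
      case (elim y)
      have "(p y + q y) *\<^sub>R max 0 (enn2real (RN_deriv \<nu> P y) - a * enn2real (RN_deriv \<nu> Q y))
          = max 0 ((p y + q y) * enn2real (RN_deriv \<nu> P y)
                   - a * ((p y + q y) * enn2real (RN_deriv \<nu> Q y)))"
        using p0[of y] q0[of y]
        by (simp add: max_mult_distrib_left algebra_simps)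
      then show ?case using elim by simp
    qed
  qed auto
  finally show ?thesis .
qed

lemma tradeoff_nonneg:
  assumes P: "prob_space P" and "\<alpha> \<in> {0..1}" and "space Q = space P"
  shows "0 \<le> tradeoff P Q \<alpha>"
  unfolding tradeoff_def
proof (rule cInf_greatest)
  interpret P: prob_space P by fact
  have "hypothesis_test P (\<lambda>_. \<alpha>) \<and> (LINT z|P. \<alpha>) = \<alpha>"
    using assms by (simp add: hypothesis_test_def P.prob_space)
  then show "{(LINT z|Q. 1 - h z) | h. hypothesis_test P h \<and> (LINT z|P. h z) = \<alpha>} \<noteq> {}"
    by blast
next
  fix x assume "x \<in> {(LINT z|Q. 1 - h z) | h. hypothesis_test P h \<and> (LINT z|P. h z) = \<alpha>}"
  then show "0 \<le> x"
    using assms(3) by (auto simp: hypothesis_test_def intro!: integral_nonneg_AE AE_I2)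
qed

lemma optimal_tradeoff_function_exists:
  assumes M: "\<And>X. M X \<in> space (prob_algebra N)"
  shows "\<exists>f. optimal_tradeoff_function M R f"
proof -
  define T where "T = {g. tradeoff_function g \<and> f_DP M R g}"
  define F where "F = (\<lambda>\<alpha>. SUP g\<in>T. g \<alpha>)"
  have "0 \<le> tradeoff (M X) (M X') \<alpha>" if "\<alpha> \<in> {0..1}" for X X' \<alpha>
    using M[of X] M[of X'] that
    by (intro tradeoff_nonneg sets_eq_imp_space_eq) (simp_all add: space_prob_algebra)
  then have zero: "(\<lambda>_. 0) \<in> T"
    by (auto simp: T_def tradeoff_function_def f_DP_def monotone_on_def convex_on_const)
  have T: "g \<in> {0..1} \<rightarrow> {0..1}" "convex_on {0..1} g" "continuous_on {0..1} g"
      "\<And>a b. 0 \<le> a \<Longrightarrow> a \<le> b \<Longrightarrow> b \<le> 1 \<Longrightarrow> g b \<le> g a"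
      "\<And>a. a \<in> {0..1} \<Longrightarrow> g a \<le> 1 - a"
      "\<And>a. a \<in> {0..1} \<Longrightarrow> 0 \<le> g a"
      "\<And>X X' a. R X X' \<Longrightarrow> a \<in> {0..1} \<Longrightarrow> g a \<le> tradeoff (M X) (M X') a"
    if "g \<in> T" for g
    using that by (auto simp: T_def tradeoff_function_def f_DP_def monotone_on_def Pi_iff)
  have bdd: "bdd_above ((\<lambda>g. g a) ` T)" if "a \<in> {0..1}" for a
    using T(5) that by (intro bdd_aboveI2[where M = "1 - a"]) auto
  have upper: "g a \<le> F a" if "g \<in> T" "a \<in> {0..1}" for g a
    unfolding F_def using that bdd by (intro cSUP_upper) auto
  have least: "F a \<le> c" if "\<And>g. g \<in> T \<Longrightarrow> g a \<le> c" for a c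
    unfolding F_def using zero that by (intro cSUP_least) auto
  have nonneg: "0 \<le> F a" if "a \<in> {0..1}" for a
    using upper[OF zero that] by simp
  have le: "F a \<le> 1 - a" if "a \<in> {0..1}" for a
    using T(5) that by (intro least) auto
  have mono: "F b \<le> F a" if "0 \<le> a" "a \<le> b" "b \<le> 1" for a b
    using that by (intro least order_trans[OF T(4) upper]) auto
  have convex: "convex_on {0..1} F"
  proof (rule convex_onI)
    fix t x y :: real
    assume *: "0 < t" "t < 1" "x \<in> {0..1}" "y \<in> {0..1}"
    show "F ((1 - t) *\<^sub>R x + t *\<^sub>R y) \<le> (1 - t) * F x + t * F y"
    proof (rule least)
      fix g assume g: "g \<in> T"
      have "g ((1 - t) *\<^sub>R x + t *\<^sub>R y) \<le> (1 - t) * g x + t * g y"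
        using * by (intro convex_onD[OF T(2)[OF g]]) auto
      also have "\<dots> \<le> (1 - t) * F x + t * F y"
        using * upper[OF g] by (intro add_mono mult_left_mono) auto
      finally show "g ((1 - t) *\<^sub>R x + t *\<^sub>R y) \<le> (1 - t) * F x + t * F y" .
    qed
  qed simp
  have cont: "continuous_on {0..1} F"
    unfolding continuous_on_eq_continuous_within
  proof
    fix x :: real assume x: "x \<in> {0..1}"
    consider "x = 0" | "x = 1" | "x \<in> {0<..<1}" using x by force
    then show "continuous (at x within {0..1}) F"
    proof cases
      case 1
      have "(F \<longlongrightarrow> F 0) (at 0 within {0..1})"
      proof (rule order_tendstoI)
        fix c assume "c < F 0"
        then obtain g where g: "g \<in> T" "c < g 0"
          unfolding F_def using zero bdd[of 0] by (subst (asm) less_cSUP_iff) auto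
        have "(g \<longlongrightarrow> g 0) (at 0 within {0..1})"
          using T(3)[OF g(1)] by (simp add: continuous_on_def)
        then have "\<forall>\<^sub>F y in at 0 within {0..1}. c < g y"
          using g(2) by (rule order_tendstoD)
        moreover have "\<forall>\<^sub>F y in at 0 within {0..1}. y \<in> {0..(1::real)}"
          by (simp add: eventually_at_filter)
        ultimately show "\<forall>\<^sub>F y in at 0 within {0..1}. c < F y"
          by eventually_elim (use upper[OF g(1)] in force)
      next
        fix c assume c: "F 0 < c"
        have "\<forall>\<^sub>F y in at 0 within {0..1}. y \<in> {0..(1::real)}"
          by (simp add: eventually_at_filter)
        then show "\<forall>\<^sub>F y in at 0 within {0..1}. F y < c"
          by eventually_elim (use c mono[of 0] in force)
      qed
      then show ?thesis using 1 by (simp add: continuous_within)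
    next
      case 2
      have ev: "\<forall>\<^sub>F y in at 1 within {0..1}. y \<in> {0..(1::real)}"
        by (simp add: eventually_at_filter)
      have lim: "((\<lambda>y. 1 - y) \<longlongrightarrow> 0) (at 1 within {0..(1::real)})"
        by (auto intro!: tendsto_eq_intros)
      have "(F \<longlongrightarrow> 0) (at 1 within {0..1})"
        by (rule tendsto_sandwich[OF _ _ tendsto_const lim])
           (use ev nonneg le in \<open>auto elim!: eventually_mono\<close>)
      moreover have "F 1 = 0" using nonneg[of 1] le[of 1] by simp
      ultimately show ?thesis using 2 by (simp add: continuous_within)
    next
      case 3
      have "continuous_on {0<..<1} F"
        by (rule convex_on_continuous)
           (auto intro: convex_on_subset[OF convex])
      then have "isCont F x" using 3 by (simp add: continuous_on_eq_continuous_at)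
      then show ?thesis by (rule continuous_at_imp_continuous_at_within)
    qed
  qed
  have "F \<in> {0..1} \<rightarrow> {0..1}"
    using nonneg le by force
  then have "tradeoff_function F"
    unfolding tradeoff_function_def using convex cont mono le by (auto simp: monotone_on_def)
  moreover have "f_DP M R F"
    unfolding f_DP_def using T(7) by (auto intro: least)
  ultimately have "optimal_tradeoff_function M R F"
    unfolding optimal_tradeoff_function_def using upper by (auto simp: T_def)
  then show ?thesis by blast
qed

end

theory Submission
  imports Defs
begin

text \<open>
  The hockey-stick divergence is a maximum over tests,
  \<open>D\<^sub>a(P\<parallel>Q) = max\<^sub>h (E\<^sub>P h - a E\<^sub>Q h)\<close>, attained at the indicator of \<open>p \<ge> a q\<close>.
  Replacing \<open>h\<close> by \<open>1 - h\<close>, a bound \<open>\<delta>(\<epsilon>) \<le> d\<close> says that every tradeoff function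
  \<open>\<Lambda>(M X\<parallel>M X')\<close> lies above the line \<open>\<alpha> \<mapsto> exp (-\<epsilon>) (1 - d - \<alpha>)\<close>. Hence the
  supremum \<open>g\<close> of the lines with \<open>d = \<delta>(\<epsilon>)\<close> is a tradeoff function satisfied by \<open>M\<close>, and
  \<open>g \<le> f\<close> by optimality. Conversely every supporting line of the convex function \<open>f\<close> with
  negative slope \<open>-exp (-\<epsilon>)\<close> lies below the line for \<open>\<delta>(\<epsilon>)\<close>, so \<open>f \<le> g\<close>.
  The same two inequalities give \<open>\<delta>(\<epsilon>) = sup\<^sub>s (1 - s - exp \<epsilon> f(s))\<close>, which is the
  conjugate formula after the substitution \<open>s = f\<^sup>-\<^sup>1(t)\<close>.
\<close>

section \<open>Elementary facts on hypothesis tests\<close>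

lemma hypothesis_test_const: "c \<in> {0..1} \<Longrightarrow> hypothesis_test P (\<lambda>_. c)"
  by (simp add: hypothesis_test_def)

lemma hypothesis_test_complement: "hypothesis_test P h \<Longrightarrow> hypothesis_test P (\<lambda>y. 1 - h y)"
  by (auto simp: hypothesis_test_def)

lemma hypothesis_test_cong_sets:
  assumes "sets P = sets Q"
  shows "hypothesis_test P h \<longleftrightarrow> hypothesis_test Q h"
  unfolding hypothesis_test_def measurable_cong_sets[OF assms refl] sets_eq_imp_space_eq[OF assms] ..

lemma hypothesis_test_integrable:
  assumes "prob_space P" "hypothesis_test P h"
  shows "integrable P h"
proof -
  interpret prob_space P by fact
  show ?thesis
    using assms(2)
    by (intro integrable_const_bound[where B = 1]) (auto simp: hypothesis_test_def)
qed

lemma hypothesis_test_integral_in_unit: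
  assumes "prob_space P" "hypothesis_test P h"
  shows "(LINT y|P. h y) \<in> {0..1}"
proof -
  interpret prob_space P by fact
  have "(LINT y|P. h y) \<le> (LINT y|P. 1)"
    using hypothesis_test_integrable[OF assms] assms(2)
    by (intro integral_mono) (auto simp: hypothesis_test_def)
  moreover have "0 \<le> (LINT y|P. h y)"
    using assms(2) by (intro integral_nonneg_AE AE_I2) (auto simp: hypothesis_test_def)
  ultimately show ?thesis by (simp add: prob_space)
qed

lemma integral_complement:
  assumes "prob_space P" "hypothesis_test P h"
  shows "(LINT y|P. 1 - h y) = 1 - (LINT y|P. h y)"
proof -
  interpret prob_space P by fact
  show ?thesis
    using hypothesis_test_integrable[OF assms] by (simp add: prob_space)
qed

section \<open>The hockey-stick divergence as a maximum over tests\<close>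

text \<open>Both measures are dominated by their sum, a finite measure, so Radon-Nikodym applies.
  The derivatives are replaced by real versions that are nonnegative everywhere, which is the form
  that \<open>hockey_stick_eq\<close> takes.\<close>

lemma ex_common_densities:
  assumes P: "prob_space P" and Q: "prob_space Q" and s: "sets Q = sets P"
  obtains \<mu> and p q :: "'y \<Rightarrow> real"
  where "p \<in> borel_measurable \<mu>" "q \<in> borel_measurable \<mu>" "\<And>y. 0 \<le> p y" "\<And>y. 0 \<le> q y"
    "P = density \<mu> (\<lambda>y. ennreal (p y))" "Q = density \<mu> (\<lambda>y. ennreal (q y))"
proof -
  interpret P: prob_space P by fact
  interpret Q: prob_space Q by fact
  define \<mu> where "\<mu> = add_measure P Q"
  have s\<mu>: "sets \<mu> = sets P" by (simp add: \<mu>_def)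
  have em: "emeasure \<mu> A = emeasure P A + emeasure Q A" if "A \<in> sets P" for A
    unfolding \<mu>_def by (rule emeasure_add_measure[OF s that])
  interpret \<mu>: finite_measure \<mu>
    using em[OF sets.top] P.emeasure_finite Q.emeasure_finite
    by (intro finite_measureI) (simp add: \<mu>_def)
  have density: "\<exists>d. d \<in> borel_measurable \<mu> \<and> (\<forall>y. 0 \<le> d y) \<and>
      D = density \<mu> (\<lambda>y. ennreal (d y))"
    if "prob_space D" and sD: "sets D = sets \<mu>"
      and le: "\<And>A. A \<in> sets P \<Longrightarrow> emeasure D A \<le> emeasure \<mu> A" for D
  proof -
    interpret D: prob_space D by fact
    have ac: "absolutely_continuous \<mu> D"
      unfolding absolutely_continuous_def null_sets_def
      using le by (force simp: sD s\<mu>)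
    obtain d where [measurable]: "d \<in> borel_measurable \<mu>"
      and d: "AE y in \<mu>. RN_deriv \<mu> D y = ennreal (d y)" "\<And>y. 0 \<le> d y"
      using \<mu>.real_RN_deriv[OF D.finite_measure_axioms ac sD] by blast
    have "D = density \<mu> (RN_deriv \<mu> D)"
      by (rule \<mu>.density_RN_deriv[OF ac sD, symmetric])
    also have "\<dots> = density \<mu> (\<lambda>y. ennreal (d y))"
      using d(1) by (intro density_cong) auto
    finally show ?thesis using d(2) \<open>d \<in> borel_measurable \<mu>\<close> by blast
  qed
  obtain p where p: "p \<in> borel_measurable \<mu>" "\<And>y. 0 \<le> p y" "P = density \<mu> (\<lambda>y. ennreal (p y))"
    using density[OF P s\<mu>[symmetric]] em by (metis add.right_neutral add_left_mono zero_le)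
  obtain q where q: "q \<in> borel_measurable \<mu>" "\<And>y. 0 \<le> q y" "Q = density \<mu> (\<lambda>y. ennreal (q y))"
    using density[OF Q] em s s\<mu> by (metis add.left_neutral add_right_mono zero_le)
  show ?thesis by (rule that[OF p(1) q(1) p(2) q(2) p(3) q(3)])
qed

text \<open>Neyman-Pearson: in terms of densities the objective is the integral of
  \<open>h * (p - a * q)\<close>, and \<open>h\<close> in [0,1] bounds the integrand pointwise by
  the positive part of \<open>p - a * q\<close>.\<close>

lemma hockey_stick_upper_and_attained:
  assumes P: "prob_space P" and Q: "prob_space Q" and s: "sets Q = sets P"
  shows hockey_stick_upper:
      "hypothesis_test P h \<Longrightarrow> (LINT y|P. h y) - a * (LINT y|Q. h y) \<le> hockey_stick a P Q"
    and hockey_stick_attained: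
      "\<exists>h. hypothesis_test P h \<and> hockey_stick a P Q = (LINT y|P. h y) - a * (LINT y|Q. h y)"
proof -
  obtain \<mu> and p q :: "'a \<Rightarrow> real"
    where [measurable]: "p \<in> borel_measurable \<mu>" "q \<in> borel_measurable \<mu>"
      and nn: "\<And>y. 0 \<le> p y" "\<And>y. 0 \<le> q y"
      and d: "P = density \<mu> (\<lambda>y. ennreal (p y))" "Q = density \<mu> (\<lambda>y. ennreal (q y))"
    by (rule ex_common_densities[OF assms]) blast
  have sP: "sets P = sets \<mu>" by (simp add: d)
  have eq: "hockey_stick a P Q = (LINT y|\<mu>. max 0 (p y - a * q y))"
    by (rule hockey_stick_eq[OF P Q _ _ nn d]) simp_all
  have test_D: "h \<in> borel_measurable \<mu>" "\<And>y. y \<in> space \<mu> \<Longrightarrow> 0 \<le> h y"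
      "\<And>y. y \<in> space \<mu> \<Longrightarrow> h y \<le> 1" if "hypothesis_test P h" for h
    using that unfolding hypothesis_test_cong_sets[OF sP] by (auto simp: hypothesis_test_def)
  have int: "integrable \<mu> (\<lambda>y. p y * h y)" "integrable \<mu> (\<lambda>y. q y * h y)"
    if "hypothesis_test P h" for h
    using hypothesis_test_integrable[OF P that]
      hypothesis_test_integrable[OF Q, unfolded hypothesis_test_cong_sets[OF s], OF that]
      test_D(1)[OF that] nn
    by (simp_all add: d integrable_density)
  have diff: "(LINT y|P. h y) - a * (LINT y|Q. h y) = (LINT y|\<mu>. p y * h y - a * (q y * h y))"
    if "hypothesis_test P h" for h
  proof -
    have "(LINT y|P. h y) = (LINT y|\<mu>. p y * h y)" "(LINT y|Q. h y) = (LINT y|\<mu>. q y * h y)"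
      using test_D(1)[OF that] nn by (simp_all add: d integral_density)
    then show ?thesis using int[OF that] by simp
  qed
  \<comment> \<open>Integrability of the densities is the case of the constant test 1.\<close>
  have ip: "integrable \<mu> p" "integrable \<mu> q"
    using int[OF hypothesis_test_const[of 1]] by simp_all
  show "(LINT y|P. h y) - a * (LINT y|Q. h y) \<le> hockey_stick a P Q" if h: "hypothesis_test P h"
    unfolding diff[OF h] eq
  proof (rule integral_mono)
    show "integrable \<mu> (\<lambda>y. p y * h y - a * (q y * h y))" using int[OF h] by simp
    show "integrable \<mu> (\<lambda>y. max 0 (p y - a * q y))" using ip by simp
    fix y assume "y \<in> space \<mu>"
    note h01 = test_D(2,3)[OF h this]
    have "p y * h y - a * (q y * h y) = h y * (p y - a * q y)" by (simp add: algebra_simps)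
    also have "\<dots> \<le> h y * max 0 (p y - a * q y)" using h01 by (intro mult_left_mono) auto
    also have "\<dots> \<le> 1 * max 0 (p y - a * q y)" using h01 by (intro mult_right_mono) auto
    finally show "p y * h y - a * (q y * h y) \<le> max 0 (p y - a * q y)" by simp
  qed
  \<comment> \<open>On the tie set \<open>p y = a * q y\<close> the integrand vanishes, so the value
    of the test there does not affect optimality.\<close>
  define k where "k y = (if p y \<ge> a * q y then 1 else 0 :: real)" for y
  have k: "hypothesis_test P k"
    unfolding hypothesis_test_cong_sets[OF sP] unfolding hypothesis_test_def k_def by auto
  have "hockey_stick a P Q = (LINT y|P. k y) - a * (LINT y|Q. k y)"
    unfolding diff[OF k] eq by (rule Bochner_Integration.integral_cong) (auto simp: k_def)
  with k show "\<exists>h. hypothesis_test P h \<and>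
      hockey_stick a P Q = (LINT y|P. h y) - a * (LINT y|Q. h y)" by blast
qed

section \<open>Suprema of the dual lines\<close>

lemma exp_minus_mult_le_iff:
  fixes x y \<epsilon> :: real
  shows "exp (- \<epsilon>) * x \<le> y \<longleftrightarrow> x \<le> exp \<epsilon> * y"
proof -
  have "exp (- \<epsilon>) * x \<le> y \<longleftrightarrow> exp \<epsilon> * (exp (- \<epsilon>) * x) \<le> exp \<epsilon> * y" by simp
  also have "exp \<epsilon> * (exp (- \<epsilon>) * x) = x" by (simp flip: mult.assoc exp_add)
  finally show ?thesis .
qed

text \<open>The bounds on \<delta> are those that the constant tests and the range of the divergence
  provide. \<open>nonneg\<close> puts the lines with \<epsilon> \<ge> 0 below 1 - \<alpha>,
  \<open>ge\<close> does so for \<epsilon> < 0, and \<open>le1\<close> makes the supremum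
  nonnegative. Convexity and monotonicity pass from the affine lines to their supremum; only
  continuity at the endpoints needs an extra argument.\<close>

lemma tradeoff_function_SUP:
  fixes \<delta> :: "real \<Rightarrow> real"
  assumes nonneg: "\<And>\<epsilon>. 0 \<le> \<delta> \<epsilon>" and le1: "\<And>\<epsilon>. \<delta> \<epsilon> \<le> 1" and ge: "\<And>\<epsilon>. 1 - exp \<epsilon> \<le> \<delta> \<epsilon>"
  defines "L \<equiv> \<lambda>\<epsilon> \<alpha>. exp (- \<epsilon>) * (1 - \<delta> \<epsilon> - \<alpha>)"
  shows "tradeoff_function (\<lambda>\<alpha>. SUP \<epsilon>. L \<epsilon> \<alpha>)"
    and "\<And>\<epsilon> \<alpha>. \<alpha> \<in> {0..1} \<Longrightarrow> L \<epsilon> \<alpha> \<le> 1 - \<alpha>"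
proof -
  define g where "g \<alpha> = (SUP \<epsilon>. L \<epsilon> \<alpha>)" for \<alpha>
  show L_le: "L \<epsilon> \<alpha> \<le> 1 - \<alpha>" if "\<alpha> \<in> {0..1}" for \<epsilon> \<alpha>
  proof (cases "\<epsilon> \<ge> 0")
    case True
    have "L \<epsilon> \<alpha> \<le> exp (- \<epsilon>) * (1 - \<alpha>)"
      unfolding L_def using nonneg[of \<epsilon>] by (intro mult_left_mono) auto
    also have "\<dots> \<le> 1 * (1 - \<alpha>)"
      using True that by (intro mult_right_mono) auto
    finally show ?thesis by simp
  next
    case False
    have "L \<epsilon> \<alpha> \<le> exp (- \<epsilon>) * (exp \<epsilon> - \<alpha>)"
      unfolding L_def using ge[of \<epsilon>] by (intro mult_left_mono) auto
    also have "\<dots> = 1 - exp (- \<epsilon>) * \<alpha>" by (simp add: algebra_simps flip: exp_add)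
    also have "\<dots> \<le> 1 - 1 * \<alpha>"
      using False that by (intro diff_left_mono mult_right_mono) auto
    finally show ?thesis by simp
  qed
  have bdd: "bdd_above (range (\<lambda>\<epsilon>. L \<epsilon> \<alpha>))" if "\<alpha> \<in> {0..1}" for \<alpha>
    using L_le[OF that] by (rule bdd_aboveI2)
  have upper: "L \<epsilon> \<alpha> \<le> g \<alpha>" if "\<alpha> \<in> {0..1}" for \<epsilon> \<alpha>
    unfolding g_def using bdd[OF that] by (intro cSUP_upper) auto
  have least: "g \<alpha> \<le> c" if "\<And>\<epsilon>. L \<epsilon> \<alpha> \<le> c" for \<alpha> c
    unfolding g_def using that by (intro cSUP_least) auto
  have le: "g \<alpha> \<le> 1 - \<alpha>" if "\<alpha> \<in> {0..1}" for \<alpha>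
    using L_le[OF that] by (rule least)
  have g_nonneg: "0 \<le> g \<alpha>" if \<alpha>: "\<alpha> \<in> {0..1}" for \<alpha>
  proof -
    \<comment> \<open>An individual line may be negative at \<alpha>, but it is at least
      \<open>- exp (- \<epsilon>)\<close>, which tends to 0 as \<epsilon> grows.\<close>
    have "((\<lambda>\<epsilon>::real. exp (- \<epsilon>)) \<longlongrightarrow> 0) at_top"
      by (rule filterlim_compose[OF exp_at_bot filterlim_uminus_at_bot_at_top])
    then have "((\<lambda>\<epsilon>::real. - exp (- \<epsilon>)) \<longlongrightarrow> 0) at_top"
      using tendsto_minus by fastforce
    moreover have "- exp (- \<epsilon>) \<le> g \<alpha>" for \<epsilon>
    proof -
      have "exp (- \<epsilon>) * (-1) \<le> L \<epsilon> \<alpha>"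
        unfolding L_def using le1[of \<epsilon>] \<alpha> by (intro mult_left_mono) auto
      with upper[OF \<alpha>, of \<epsilon>] show ?thesis by simp
    qed
    ultimately show ?thesis
      by (intro tendsto_upperbound[where F = "at_top :: real filter"]) auto
  qed
  have mono: "g b \<le> g a" if "0 \<le> a" "a \<le> b" "b \<le> 1" for a b
  proof (rule least)
    fix \<epsilon>
    have "L \<epsilon> b \<le> L \<epsilon> a" unfolding L_def using that by (intro mult_left_mono) auto
    also have "\<dots> \<le> g a" using that by (intro upper) auto
    finally show "L \<epsilon> b \<le> g a" .
  qed
  have convex: "convex_on {0..1} g"
  proof (rule convex_onI)
    fix t x y :: real
    assume *: "0 < t" "t < 1" "x \<in> {0..1}" "y \<in> {0..1}"
    show "g ((1 - t) *\<^sub>R x + t *\<^sub>R y) \<le> (1 - t) * g x + t * g y"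
    proof (rule least)
      fix \<epsilon>
      have "L \<epsilon> ((1 - t) *\<^sub>R x + t *\<^sub>R y) = (1 - t) * L \<epsilon> x + t * L \<epsilon> y"
        by (simp add: L_def algebra_simps)
      also have "\<dots> \<le> (1 - t) * g x + t * g y"
        using * upper by (intro add_mono mult_left_mono) auto
      finally show "L \<epsilon> ((1 - t) *\<^sub>R x + t *\<^sub>R y) \<le> (1 - t) * g x + t * g y" .
    qed
  qed simp
  have ev: "\<forall>\<^sub>F y in at x within {0..1}. y \<in> {0..(1::real)}" for x
    by (simp add: eventually_at_filter)
  have "continuous (at x within {0..1}) g" if x: "x \<in> {0..1}" for x
  proof -
    consider "x = 0" | "x = 1" | "x \<in> {0<..<1}" using x by force
    then show ?thesis
    proof cases
      case 1
      have "(g \<longlongrightarrow> g 0) (at 0 within {0..1})"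
      \<comment> \<open>The lower bound near 0 comes from one continuous line that exceeds
        \<open>c\<close> at 0, the upper bound from monotonicity.\<close>
      proof (rule order_tendstoI)
        fix c assume "c < g 0"
        then obtain \<epsilon> where \<epsilon>: "c < L \<epsilon> 0"
          unfolding g_def using bdd[of 0] by (subst (asm) less_cSUP_iff) auto
        have "(L \<epsilon> \<longlongrightarrow> L \<epsilon> 0) (at 0 within {0..1})"
          unfolding L_def by (intro tendsto_intros)
        from order_tendstoD(1)[OF this \<epsilon>] ev
        show "\<forall>\<^sub>F y in at 0 within {0..1}. c < g y"
          by eventually_elim (use upper[of _ \<epsilon>] in force)
      next
        fix c assume c: "g 0 < c"
        show "\<forall>\<^sub>F y in at 0 within {0..1}. g y < c"
          using ev by eventually_elim (use c mono[of 0] in force)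
      qed
      then show ?thesis using 1 by (simp add: continuous_within)
    next
      case 2
      have lim: "((\<lambda>y. 1 - y) \<longlongrightarrow> 0) (at 1 within {0..(1::real)})"
        by (auto intro!: tendsto_eq_intros)
      \<comment> \<open>At 1 the function is squeezed between 0 and \<open>1 - y\<close>.\<close>
      have "(g \<longlongrightarrow> 0) (at 1 within {0..1})"
        by (rule tendsto_sandwich[OF _ _ tendsto_const lim])
           (use eventually_mono[OF ev g_nonneg] eventually_mono[OF ev le] in auto)
      moreover have "g 1 = 0" using g_nonneg[of 1] le[of 1] by simp
      ultimately show ?thesis using 2 by (simp add: continuous_within)
    next
      case 3
      have "continuous_on {0<..<1} g"
        by (rule convex_on_continuous) (auto intro: convex_on_subset[OF convex])
      then have "isCont g x" using 3 by (simp add: continuous_on_eq_continuous_at)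
      then show ?thesis by (rule continuous_at_imp_continuous_at_within)
    qed
  qed
  then have cont: "continuous_on {0..1} g"
    by (simp add: continuous_on_eq_continuous_within)
  have "g \<in> {0..1} \<rightarrow> {0..1}" using g_nonneg le by force
  then show "tradeoff_function (\<lambda>\<alpha>. SUP \<epsilon>. L \<epsilon> \<alpha>)"
    unfolding g_def[symmetric] tradeoff_function_def
    using convex cont mono le by (auto simp: monotone_on_def)
qed

section \<open>Supporting lines of tradeoff functions\<close>

lemma tradeoff_functionD:
  assumes "tradeoff_function f"
  shows "convex_on {0..1} f" "continuous_on {0..1} f"
    and "\<And>\<alpha>. \<alpha> \<in> {0..1} \<Longrightarrow> 0 \<le> f \<alpha>" "\<And>\<alpha>. \<alpha> \<in> {0..1} \<Longrightarrow> f \<alpha> \<le> 1 - \<alpha>"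
    and "f 1 = 0"
proof -
  show *: "convex_on {0..1} f" "continuous_on {0..1} f"
    "\<And>\<alpha>. \<alpha> \<in> {0..1} \<Longrightarrow> 0 \<le> f \<alpha>" "\<And>\<alpha>. \<alpha> \<in> {0..1} \<Longrightarrow> f \<alpha> \<le> 1 - \<alpha>"
    using assms by (auto simp: tradeoff_function_def Pi_iff)
  show "f 1 = 0" using *(3,4)[of 1] by simp
qed

text \<open>A convex function has a supporting line at an interior point. Since
  \<open>f 1 = 0\<close> and \<open>f \<alpha> > 0\<close>, this line must fall strictly, so its
  slope has the form \<open>- exp (- \<epsilon>)\<close>.\<close>

lemma tradeoff_function_supporting_line:
  assumes f: "tradeoff_function f" and \<alpha>: "\<alpha> \<in> {0<..<1}" and pos: "0 < f \<alpha>"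
  obtains \<epsilon> :: real where "\<And>s. s \<in> {0..1} \<Longrightarrow> f \<alpha> - exp (- \<epsilon>) * (s - \<alpha>) \<le> f s"
proof -
  \<comment> \<open>\<open>- m\<close> is the right derivative of \<open>f\<close> at \<alpha>, the
    infimum of the difference quotients to the right, and hence a subgradient.\<close>
  define m where "m = - Inf ((\<lambda>t. (f \<alpha> - f t) / (\<alpha> - t)) ` ({\<alpha><..} \<inter> {0..1}))"
  have line: "f \<alpha> - m * (s - \<alpha>) \<le> f s" if "s \<in> {0..1}" for s
    using convex_le_Inf_differential[OF tradeoff_functionD(1)[OF f], of \<alpha> s] \<alpha> that
    by (simp add: m_def algebra_simps)
  have "0 < m * (1 - \<alpha>)"
    using line[of 1] pos tradeoff_functionD(5)[OF f] by simp
  then have "0 < m" using \<alpha> by (simp add: zero_less_mult_iff)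
  then show ?thesis using line by (intro that[of "- ln m"]) simp
qed

section \<open>The inverse and its conjugate\<close>

lemma tradeoff_inverse_le:
  assumes "s \<in> {0..1}" "f s \<le> t"
  shows "tradeoff_inverse f t \<le> s"
  unfolding tradeoff_inverse_def
proof (rule cInf_lower)
  show "bdd_below {s \<in> {0..1}. f s \<le> t}" by (rule bdd_belowI[of _ 0]) auto
qed (use assms in simp)

text \<open>Continuity makes the sublevel set closed, and \<open>f 1 = 0\<close> puts 1 into it, so
  the infimum is a minimum.\<close>

lemma tradeoff_inverse_attained:
  assumes f: "tradeoff_function f" and t: "0 \<le> t"
  shows "tradeoff_inverse f t \<in> {0..1}" "f (tradeoff_inverse f t) \<le> t"
proof -
  have "closed {s \<in> {0..1}. f s \<le> t}"
    using tradeoff_functionD(2)[OF f]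
    by (intro continuous_on_closed_Collect_le continuous_intros) auto
  moreover have "1 \<in> {s \<in> {0..1}. f s \<le> t}"
    using tradeoff_functionD(5)[OF f] t by simp
  ultimately have "tradeoff_inverse f t \<in> {s \<in> {0..1}. f s \<le> t}"
    unfolding tradeoff_inverse_def
    by (intro closed_contains_Inf) (auto intro: bdd_belowI[of _ 0])
  then show "tradeoff_inverse f t \<in> {0..1}" "f (tradeoff_inverse f t) \<le> t" by auto
qed

text \<open>The two suprema dominate each other termwise although \<open>f\<close> need not be
  injective: \<open>s = tradeoff_inverse f t\<close> satisfies \<open>f s \<le> t\<close>, and
  \<open>t = f s\<close> satisfies \<open>tradeoff_inverse f t \<le> s\<close>.\<close>

lemma convex_conjugate_tradeoff_inverse:
  assumes f: "tradeoff_function f" and a: "0 \<le> a"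
  shows "convex_conjugate (tradeoff_inverse f) (- a) = (SUP s\<in>{0..1}. ereal (- s - a * f s))"
  unfolding convex_conjugate_def
proof (rule antisym)
  show "(SUP t\<in>{0..1}. ereal (- a * t - tradeoff_inverse f t)) \<le>
      (SUP s\<in>{0..1}. ereal (- s - a * f s))"
  proof (rule SUP_mono)
    fix t :: real assume "t \<in> {0..1}"
    then have "tradeoff_inverse f t \<in> {0..1}" "a * f (tradeoff_inverse f t) \<le> a * t"
      using tradeoff_inverse_attained[OF f, of t] a by (auto intro: mult_left_mono)
    then show "\<exists>s\<in>{0..1}. ereal (- a * t - tradeoff_inverse f t) \<le> ereal (- s - a * f s)"
      by (intro bexI[of _ "tradeoff_inverse f t"]) auto
  qed
  show "(SUP s\<in>{0..1}. ereal (- s - a * f s)) \<le>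
      (SUP t\<in>{0..1}. ereal (- a * t - tradeoff_inverse f t))"
  proof (rule SUP_mono)
    fix s :: real assume s: "s \<in> {0..1}"
    then have "f s \<in> {0..1}" using tradeoff_functionD(3,4)[OF f s] by auto
    with s show "\<exists>t\<in>{0..1}. ereal (- s - a * f s) \<le> ereal (- a * t - tradeoff_inverse f t)"
      using tradeoff_inverse_le[of s f "f s"] by (intro bexI[of _ "f s"]) auto
  qed
qed

section \<open>Differential privacy in terms of tests\<close>

text \<open>Lying below an infimum means lying below each member, and every test has a level in
  [0,1], so the quantifier over levels is absorbed into the one over tests.\<close>

lemma f_DP_iff_tests:
  assumes M: "\<And>X. M X \<in> space (prob_algebra N)"
  shows "f_DP M R f \<longleftrightarrow> (\<forall>X X' h. R X X' \<longrightarrow> hypothesis_test (M X) h \<longrightarrow>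
    f (LINT y|M X. h y) \<le> 1 - (LINT y|M X'. h y))"
    (is "_ \<longleftrightarrow> ?R")
proof -
  have P: "prob_space (M X)" and s: "sets (M X) = sets N" for X
    using M[of X] by (simp_all add: space_prob_algebra)
  have comp: "(LINT y|M X'. 1 - h y) = 1 - (LINT y|M X'. h y)"
    if "hypothesis_test (M X) h" for X X' h
    using that s by (intro integral_complement P) (metis hypothesis_test_cong_sets)
  show ?thesis
  proof
    assume f: "f_DP M R f"
    show ?R
    proof (intro allI impI)
      fix X X' h assume R: "R X X'" and h: "hypothesis_test (M X) h"
      define A where "A = {(LINT z|M X'. 1 - k z) | k. hypothesis_test (M X) k \<and>
        (LINT z|M X. k z) = (LINT y|M X. h y)}"
      have "bdd_below A"
        using sets_eq_imp_space_eq[of "M X" "M X'"] s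
        by (intro bdd_belowI[of _ 0])
           (auto simp: A_def hypothesis_test_def intro!: integral_nonneg_AE AE_I2)
      moreover have "1 - (LINT y|M X'. h y) \<in> A"
        unfolding A_def using comp[OF h, of X', symmetric] h by blast
      ultimately have "tradeoff (M X) (M X') (LINT y|M X. h y) \<le> 1 - (LINT y|M X'. h y)"
        unfolding tradeoff_def A_def[symmetric] by (rule cInf_lower[rotated])
      then show "f (LINT y|M X. h y) \<le> 1 - (LINT y|M X'. h y)"
        using f R hypothesis_test_integral_in_unit[OF P h] unfolding f_DP_def by fastforce
    qed
  next
    assume r: ?R
    show "f_DP M R f"
      unfolding f_DP_def tradeoff_def
    proof (intro allI impI ballI cInf_greatest)
      fix X X' and \<alpha> :: real assume "R X X'" and \<alpha>: "\<alpha> \<in> {0..1}"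
      interpret prob_space "M X" by (rule P)
      \<comment> \<open>The constant test \<alpha> has level \<alpha>.\<close>
      show "{(LINT z|M X'. 1 - h z) |h. hypothesis_test (M X) h \<and> (LINT z|M X. h z) = \<alpha>} \<noteq> {}"
        using hypothesis_test_const[OF \<alpha>, of "M X"] prob_space by force
    next
      fix X X' \<alpha> x
      assume "R X X'"
        "x \<in> {(LINT z|M X'. 1 - h z) |h. hypothesis_test (M X) h \<and> (LINT z|M X. h z) = \<alpha>}"
      then show "f \<alpha> \<le> x" using r comp by fastforce
    qed
  qed
qed

section \<open>Duality of the optimal tradeoff function and the privacy profile\<close>

theorem theorem4p3:
  fixes N :: "'y measure"
    and M :: "'x \<Rightarrow> 'y measure"
    and R :: "'x \<Rightarrow> 'x \<Rightarrow> bool"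
    and f :: "real \<Rightarrow> real"
  assumes "\<And>X. M X \<in> space (prob_algebra N)"
    and "\<exists>X X'. R X X'"
    and "optimal_tradeoff_function M R f"
  shows "(\<forall>\<epsilon>::real. ereal (privacy_profile M R \<epsilon>) =
            1 + convex_conjugate (tradeoff_inverse f) (- exp \<epsilon>)) \<and>
         (\<forall>\<alpha>\<in>{0..1}. ereal (f \<alpha>) =
            (SUP \<epsilon>::real. ereal (exp (- \<epsilon>) * (1 - privacy_profile M R \<epsilon> - \<alpha>))))"
proof -
  note M = assms(1)
  obtain X\<^sub>0 X\<^sub>0' where R0: "R X\<^sub>0 X\<^sub>0'" using assms(2) by blast
  have f: "tradeoff_function f" and fDP: "f_DP M R f"
    and opt: "\<And>f' \<alpha>. tradeoff_function f' \<Longrightarrow> f_DP M R f' \<Longrightarrow> \<alpha> \<in> {0..1} \<Longrightarrow> f' \<alpha> \<le> f \<alpha>"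
    using assms(3) by (auto simp: optimal_tradeoff_function_def)
  note fD = tradeoff_functionD[OF f]
  have P: "prob_space (M X)" and s: "sets (M X) = sets N" for X
    using M[of X] by (simp_all add: space_prob_algebra)
  have ss: "sets (M X') = sets (M X)" for X X' by (simp add: s)
  have test_M: "hypothesis_test (M X) h \<longleftrightarrow> hypothesis_test N h" for X h
    by (rule hypothesis_test_cong_sets[OF s])
  have unit: "0 \<le> (LINT y|M X. h y)" "(LINT y|M X. h y) \<le> 1" if "hypothesis_test N h" for X h
    using hypothesis_test_integral_in_unit[OF P, of X h] that by (auto simp: test_M)
  define \<delta> where "\<delta> = privacy_profile M R"
  define H where "H \<epsilon> = {hockey_stick (exp \<epsilon>) (M X) (M X') | X X'. R X X'}" for \<epsilon>
  have HS: "(LINT y|M X. h y) - exp \<epsilon> * (LINT y|M X'. h y) \<le> hockey_stick (exp \<epsilon>) (M X) (M X')"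
    if "hypothesis_test N h" for X X' \<epsilon> h
    using hockey_stick_upper[OF P P ss] that by (simp add: test_M)
  have HS_eq: "\<exists>h. hypothesis_test N h \<and>
      hockey_stick (exp \<epsilon>) (M X) (M X') = (LINT y|M X. h y) - exp \<epsilon> * (LINT y|M X'. h y)" for X X' \<epsilon>
    using hockey_stick_attained[OF P P ss, where a = "exp \<epsilon>"] by (simp add: test_M)
  have H_E: "\<exists>X X' h. R X X' \<and> hypothesis_test N h \<and>
      x = (LINT y|M X. h y) - exp \<epsilon> * (LINT y|M X'. h y)" if "x \<in> H \<epsilon>" for x \<epsilon>
    using that HS_eq[where \<epsilon> = \<epsilon>] unfolding H_def by fastforce
  have H_le1: "x \<le> 1" if x_in: "x \<in> H \<epsilon>" for x \<epsilon>
  proof -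
    obtain X X' h where h: "hypothesis_test N h"
      and x: "x = (LINT y|M X. h y) - exp \<epsilon> * (LINT y|M X'. h y)"
      using H_E[OF x_in] by blast
    have "0 \<le> exp \<epsilon> * (LINT y|M X'. h y)" using unit(1)[OF h] by simp
    with unit(2)[OF h, of X] show ?thesis by (simp add: x)
  qed
  have test_le: "(LINT y|M X. h y) - exp \<epsilon> * (LINT y|M X'. h y) \<le> \<delta> \<epsilon>"
    if "R X X'" "hypothesis_test N h" for X X' \<epsilon> h
  proof -
    have "hockey_stick (exp \<epsilon>) (M X) (M X') \<le> \<delta> \<epsilon>"
      unfolding \<delta>_def privacy_profile_def H_def[symmetric]
      using H_le1 that(1) by (intro cSup_upper bdd_aboveI[of _ 1]) (auto simp: H_def)
    with HS[OF that(2)] show ?thesis by (rule order_trans)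
  qed
  have \<delta>_least: "\<delta> \<epsilon> \<le> c" if "\<And>x. x \<in> H \<epsilon> \<Longrightarrow> x \<le> c" for \<epsilon> c
    unfolding \<delta>_def privacy_profile_def H_def[symmetric]
    using that R0 by (intro cSup_least) (auto simp: H_def)
  \<comment> \<open>The test 0 gives the first bound, the test 1 the third.\<close>
  have \<delta>: "0 \<le> \<delta> \<epsilon>" "\<delta> \<epsilon> \<le> 1" "1 - exp \<epsilon> \<le> \<delta> \<epsilon>" for \<epsilon>
    using test_le[OF R0 hypothesis_test_const[of 0 N], where \<epsilon> = \<epsilon>]
      test_le[OF R0 hypothesis_test_const[of 1 N], where \<epsilon> = \<epsilon>]
      \<delta>_least[where c = 1 and \<epsilon> = \<epsilon>] H_le1[where \<epsilon> = \<epsilon>]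
    by (simp_all add: prob_space.prob_space[OF P])
  \<comment> \<open>For a test \<open>h\<close> let \<open>s\<close> be the level of
    \<open>1 - h\<close> under \<open>M X\<close>. The privacy guarantee for \<open>1 - h\<close>
    bounds \<open>f s\<close> by the mean of \<open>h\<close> under \<open>M X'\<close>, so the
    value that \<open>h\<close> contributes is at most
    \<open>1 - s - exp \<epsilon> * f s\<close>.\<close>
  have \<delta>_le: "\<delta> \<epsilon> \<le> 1 + c" if c: "\<And>s. s \<in> {0..1} \<Longrightarrow> - s - exp \<epsilon> * f s \<le> c" for \<epsilon> c
  proof (rule \<delta>_least)
    fix x assume "x \<in> H \<epsilon>"
    then obtain X X' h where R: "R X X'" and h: "hypothesis_test N h"
      and x: "x = (LINT y|M X. h y) - exp \<epsilon> * (LINT y|M X'. h y)"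
      using H_E by blast
    have compl: "(LINT y|M Z. 1 - h y) = 1 - (LINT y|M Z. h y)" for Z
      using integral_complement[OF P] h by (simp add: test_M)
    have "hypothesis_test (M X) (\<lambda>y. 1 - h y)"
      using h by (simp add: test_M hypothesis_test_complement)
    then have "f (LINT y|M X. 1 - h y) \<le> 1 - (LINT y|M X'. 1 - h y)"
      using fDP R unfolding f_DP_iff_tests[of M N, OF M] by blast
    then have "f (1 - (LINT y|M X. h y)) \<le> (LINT y|M X'. h y)" by (simp add: compl)
    then have "exp \<epsilon> * f (1 - (LINT y|M X. h y)) \<le> exp \<epsilon> * (LINT y|M X'. h y)" by simp
    moreover have "- (1 - (LINT y|M X. h y)) - exp \<epsilon> * f (1 - (LINT y|M X. h y)) \<le> c"
      using unit[OF h, of X] by (intro c) auto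
    ultimately show "x \<le> 1 + c" unfolding x by linarith
  qed

  \<comment> \<open>Dual to primal: \<open>f\<close> is the supremum of the lines\<close>
  define g where "g \<alpha> = (SUP \<epsilon>. exp (- \<epsilon>) * (1 - \<delta> \<epsilon> - \<alpha>))" for \<alpha>
  have g: "tradeoff_function g"
    unfolding g_def using tradeoff_function_SUP(1)[of \<delta>] \<delta> by blast
  have bdd: "bdd_above (range (\<lambda>\<epsilon>. exp (- \<epsilon>) * (1 - \<delta> \<epsilon> - \<alpha>)))" if "\<alpha> \<in> {0..1}" for \<alpha>
    using tradeoff_function_SUP(2)[of \<delta>, OF \<delta> that] by (rule bdd_aboveI2)
  have g_upper: "exp (- \<epsilon>) * (1 - \<delta> \<epsilon> - \<alpha>) \<le> g \<alpha>" if "\<alpha> \<in> {0..1}" for \<epsilon> \<alpha>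
    unfolding g_def using bdd[OF that] by (intro cSUP_upper) auto
  have "f_DP M R g"
    unfolding f_DP_iff_tests[of M N, OF M]
  proof (intro allI impI)
    fix X X' h assume R: "R X X'" and "hypothesis_test (M X) h"
    then have h: "hypothesis_test N h" by (simp add: test_M)
    have compl: "(LINT y|M Z. 1 - h y) = 1 - (LINT y|M Z. h y)" for Z
      using integral_complement[OF P] h by (simp add: test_M)
    show "g (LINT y|M X. h y) \<le> 1 - (LINT y|M X'. h y)"
      unfolding g_def
    proof (rule cSUP_least)
      fix \<epsilon> :: real
      \<comment> \<open>The bound by \<delta> is applied to the complementary test, whose means are
        1 minus those of \<open>h\<close>.\<close>
      have "1 - \<delta> \<epsilon> - (LINT y|M X. h y) \<le> exp \<epsilon> * (1 - (LINT y|M X'. h y))"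
        using test_le[OF R hypothesis_test_complement[OF h], where \<epsilon> = \<epsilon>] by (simp add: compl)
      then show "exp (- \<epsilon>) * (1 - \<delta> \<epsilon> - (LINT y|M X. h y)) \<le> 1 - (LINT y|M X'. h y)"
        by (simp add: exp_minus_mult_le_iff)
    qed simp
  qed
  then have g_le_f: "g \<alpha> \<le> f \<alpha>" if "\<alpha> \<in> {0..1}" for \<alpha>
    using opt g that by blast
  have f_le_g_interior: "f \<alpha> \<le> g \<alpha>" if \<alpha>: "\<alpha> \<in> {0<..<1}" for \<alpha>
  proof (cases "f \<alpha> > 0")
    case True
    from tradeoff_function_supporting_line[OF f \<alpha> True] obtain \<epsilon>
      where line: "\<And>s. s \<in> {0..1} \<Longrightarrow> f \<alpha> - exp (- \<epsilon>) * (s - \<alpha>) \<le> f s" by blast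
    \<comment> \<open>Scaled by \<open>exp \<epsilon>\<close>, the supporting line says that
      \<open>- s - exp \<epsilon> * f s\<close> is largest at \<open>s = \<alpha>\<close>. So the
      line for \<delta> at \<epsilon> reaches \<open>f \<alpha>\<close> at \<alpha>.\<close>
    have "\<delta> \<epsilon> \<le> 1 + (- \<alpha> - exp \<epsilon> * f \<alpha>)"
    proof (rule \<delta>_le)
      fix s :: real assume "s \<in> {0..1}"
      then have "exp (- \<epsilon>) * (\<alpha> - s) \<le> f s - f \<alpha>"
        using line[of s] by (simp add: algebra_simps)
      then show "- s - exp \<epsilon> * f s \<le> - \<alpha> - exp \<epsilon> * f \<alpha>"
        unfolding exp_minus_mult_le_iff by (simp add: algebra_simps)
    qed
    moreover have "1 - \<delta> \<epsilon> - \<alpha> \<le> exp \<epsilon> * g \<alpha>"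
      using g_upper[of \<alpha> \<epsilon>] \<alpha> by (simp add: exp_minus_mult_le_iff)
    ultimately have "exp \<epsilon> * f \<alpha> \<le> exp \<epsilon> * g \<alpha>" by linarith
    then show ?thesis by simp
  next
    case False
    then show ?thesis using tradeoff_functionD(3)[OF g, of \<alpha>] \<alpha> by simp
  qed
  have f_le_g: "f \<alpha> \<le> g \<alpha>" if "\<alpha> \<in> {0..1}" for \<alpha>
  proof -
    \<comment> \<open>The endpoints, where no supporting line was constructed, follow by continuity
      of \<open>f - g\<close> on the closure.\<close>
    have "continuous_on (closure {0<..<1}) (\<lambda>x. f x - g x)"
      using fD(2) tradeoff_functionD(2)[OF g] by (auto intro!: continuous_intros)
    from continuous_le_on_closure[OF this, of \<alpha> 0] that f_le_g_interior
    show ?thesis by simp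
  qed
  have "ereal (f \<alpha>) = (SUP \<epsilon>. ereal (exp (- \<epsilon>) * (1 - \<delta> \<epsilon> - \<alpha>)))" if \<alpha>: "\<alpha> \<in> {0..1}" for \<alpha>
  proof -
    have "f \<alpha> = g \<alpha>" using g_le_f f_le_g \<alpha> by (simp add: antisym)
    also have "ereal (g \<alpha>) = (SUP \<epsilon>. ereal (exp (- \<epsilon>) * (1 - \<delta> \<epsilon> - \<alpha>)))"
    proof (rule SUP_eqI[symmetric])
      fix b assume b: "\<And>\<epsilon>. \<epsilon> \<in> UNIV \<Longrightarrow> ereal (exp (- \<epsilon>) * (1 - \<delta> \<epsilon> - \<alpha>)) \<le> b"
      show "ereal (g \<alpha>) \<le> b"
      \<comment> \<open>The real supremum agrees with the extended one: the bound \<open>b\<close>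
        is real or infinite, and the term at 0 excludes minus infinity.\<close>
      proof (cases b)
        case (real c)
        then have "g \<alpha> \<le> c" unfolding g_def using b by (intro cSUP_least) auto
        with real show ?thesis by simp
      qed (use b[of 0] in auto)
    qed (use g_upper[OF \<alpha>] in simp)
    finally show ?thesis .
  qed

  \<comment> \<open>Primal to dual: the conjugate formula\<close>
  moreover have "ereal (\<delta> \<epsilon>) = 1 + convex_conjugate (tradeoff_inverse f) (- exp \<epsilon>)" for \<epsilon>
  proof -
    \<comment> \<open>The line for \<epsilon> lies below \<open>g\<close>, hence below
      \<open>f\<close>; solved for \<delta>, this is the upper bound, while
      \<open>\<delta>_le\<close> shows that it is the least one.\<close>
    have le: "- s - exp \<epsilon> * f s \<le> \<delta> \<epsilon> - 1" if "s \<in> {0..1}" for s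
    proof -
      have "exp (- \<epsilon>) * (1 - \<delta> \<epsilon> - s) \<le> f s"
        using order_trans[OF g_upper g_le_f] that by simp
      then show ?thesis by (simp add: exp_minus_mult_le_iff)
    qed
    have "(SUP s\<in>{0..1}. ereal (- s - exp \<epsilon> * f s)) = ereal (\<delta> \<epsilon> - 1)"
    proof (rule SUP_eqI)
      fix b assume b: "\<And>s. s \<in> {0..1} \<Longrightarrow> ereal (- s - exp \<epsilon> * f s) \<le> b"
      show "ereal (\<delta> \<epsilon> - 1) \<le> b"
      proof (cases b)
        case (real c)
        then have "\<delta> \<epsilon> \<le> 1 + c" using b by (intro \<delta>_le) simp
        with real show ?thesis by simp
      qed (use b[of 0] in auto)
    qed (use le in simp)
    then show ?thesis
      using convex_conjugate_tradeoff_inverse[OF f, of "exp \<epsilon>"] by (simp add: one_ereal_def)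
  qed
  ultimately show ?thesis unfolding \<delta>_def by blast
qed

end
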